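(* Let $N>\zeta\ge0$ and $M\ge1$ be integers, $\beta\in(0,1)$, and let $a_0,\dots,a_N$ be fixed real coefficients with $a_m\ge0$ for all $m$, $\sum_{m=\zeta}^{N-1}a_m>0$ and $\sum_{m=0}^Na_m=1$. With values of $\{a_m\}$ and $\beta$ fixed, for every $k\in\{0,\dots,\zeta\}$ the roots $t_{N,M}(k,l)$ defined in the context satisfy $$t_{N,M}(k,l)<t_{N,M+1}(k,l),\quad l\in\{0,\dots,M\},$$ $$t_{N,M+1}(k,l+1)<t_{N,M}(k,l),\quad l\in\{0,\dots,M-1\},$$ $$t_{N,M+1}(k,M+1)=t_{N,M}(k,M),$$ and hence $$\epsilon_{N,M}(k,l)>\epsilon_{N,M+1}(k,l),\quad l\in\{0,\dots,M\},$$ $$\epsilon_{N,M+1}(k,l+1)>\epsilon_{N,M}(k,l),\quad l\in\{0,\dots,M-1\},$$ $$\epsilon_{N,M+1}(k,M+1)=\epsilon_{N,M}(k,M).$$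
   Context: For integers $M\ge1$ and $0\le l\le M$ let $B_M(t;l)=\sum_{i=0}^l\binom{M}{i}t^i(1-t)^{M-i}$. For $k\in\{0,\dots,\zeta\}$ and $l\in\{0,\dots,M\}$ let $$h_{N,M}(t;k,l)=\beta\sum_{m=k}^Na_m\binom{m}{k}t^{m-k}-\binom{N}{k}t^{N-k}B_M(1-t;l).$$ Under the stated conditions on $\beta$ and $(a_m)$ this polynomial has exactly one root in $(0,1)$, denoted $t_{N,M}(k,l)$, and $\epsilon_{N,M}(k,l)=1-t_{N,M}(k,l)$. The quantities $t_{N,M+1}(k,l)$, $\epsilon_{N,M+1}(k,l)$ are defined in the same way with $M+1$ in place of $M$ and the same $N$, $\beta$, $(a_m)$. *)

theory Defs
  imports Complex_Main
begin

definition Bpoly :: "nat \<Rightarrow> real \<Rightarrow> nat \<Rightarrow> real" where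
  "Bpoly M t l = (\<Sum>i=0..l. real (M choose i) * t ^ i * (1 - t) ^ (M - i))"

definition hpoly ::
  "real \<Rightarrow> (nat \<Rightarrow> real) \<Rightarrow> nat \<Rightarrow> nat \<Rightarrow> real \<Rightarrow> nat \<Rightarrow> nat \<Rightarrow> real" where
  "hpoly \<beta> a N M t k l =
     \<beta> * (\<Sum>m=k..N. a m * real (m choose k) * t ^ (m - k))
       - real (N choose k) * t ^ (N - k) * Bpoly M (1 - t) l"

text \<open>
  The definite description is meaningful only where the root in the open unit interval exists
  and is unique. This is the case for \<open>k \<le> \<zeta> < N\<close>, \<open>l \<le> M\<close>, \<open>0 < \<beta> < 1\<close> and nonnegative weights
  \<open>a\<close> that sum to 1 over \<open>{0..N}\<close> and have positive sum over \<open>{\<zeta>..N - 1}\<close>.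
\<close>

definition troot ::
  "real \<Rightarrow> (nat \<Rightarrow> real) \<Rightarrow> nat \<Rightarrow> nat \<Rightarrow> nat \<Rightarrow> nat \<Rightarrow> real" where
  "troot \<beta> a N M k l = (THE t. 0 < t \<and> t < 1 \<and> hpoly \<beta> a N M t k l = 0)"

definition eps ::
  "real \<Rightarrow> (nat \<Rightarrow> real) \<Rightarrow> nat \<Rightarrow> nat \<Rightarrow> nat \<Rightarrow> nat \<Rightarrow> real" where
  "eps \<beta> a N M k l = 1 - troot \<beta> a N M k l"

end

theory Submission
  imports Defs
begin

text \<open>
  Divide \<open>h(t;k,l)\<close> by \<open>t^(N-k)\<close>. The weighted sum becomes strictly decreasing in \<open>t\<close>, and the
  binomial distribution function \<open>B_M(1-t;l)\<close> is nondecreasing in \<open>t\<close>, so the quotient is strictly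
  decreasing on \<open>(0,1]\<close>. It is positive near \<open>0\<close> and negative at \<open>1\<close>, hence has exactly one root.
  A pointwise larger quotient has a larger root, so the three relations between roots follow from
  comparing \<open>B_(M+1)(x;l)\<close> and \<open>B_(M+1)(x;l+1)\<close> with \<open>B_M(x;l)\<close> by Pascal's rule.
\<close>

lemma Bpoly_0: "Bpoly M x 0 = (1 - x) ^ M"
  by (simp add: Bpoly_def)

lemma Bpoly_Suc:
  "Bpoly M x (Suc l) = Bpoly M x l + real (M choose Suc l) * x ^ Suc l * (1 - x) ^ (M - Suc l)"
  by (simp add: Bpoly_def)

text \<open>Probabilistically, this conditions on one trial, which fails with weight
  \<open>1 - x\<close> and succeeds with weight \<open>x\<close>.\<close>

lemma Bpoly_rec:
  "Bpoly (Suc M) x (Suc l) = (1 - x) * Bpoly M x (Suc l) + x * Bpoly M x l"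
proof (induction l)
  case 0
  show ?case
    by (cases M) (simp_all add: Bpoly_Suc Bpoly_0 algebra_simps)
next
  case (Suc l)
  \<comment> \<open>Subtraction is truncated: a factor \<open>1 - x\<close> splits off the power
    only if \<open>Suc l < M\<close>; otherwise the binomial coefficient is zero.\<close>
  have "real (M choose Suc (Suc l)) * (1 - x) ^ (M - Suc l)
      = real (M choose Suc (Suc l)) * ((1 - x) * (1 - x) ^ (M - Suc (Suc l)))"
  proof (cases "Suc l < M")
    case True
    then have "M - Suc l = Suc (M - Suc (Suc l))" by simp
    then show ?thesis by simp
  next
    case False
    then show ?thesis by simp
  qed
  note pascal = arg_cong[OF this, of "\<lambda>z. z * x ^ Suc (Suc l)"]
  have "Bpoly (Suc M) x (Suc (Suc l)) = Bpoly (Suc M) x (Suc l)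
      + real (M choose Suc l) * x ^ Suc (Suc l) * (1 - x) ^ (M - Suc l)
      + real (M choose Suc (Suc l)) * (1 - x) ^ (M - Suc l) * x ^ Suc (Suc l)"
    by (simp add: Bpoly_Suc[of "Suc M" x "Suc l"] algebra_simps del: power_Suc)
  also have "\<dots> = ((1 - x) * Bpoly M x (Suc l) + x * Bpoly M x l)
      + x * (real (M choose Suc l) * x ^ Suc l * (1 - x) ^ (M - Suc l))
      + (1 - x) * (real (M choose Suc (Suc l)) * x ^ Suc (Suc l) * (1 - x) ^ (M - Suc (Suc l)))"
    unfolding pascal Suc.IH by (simp add: mult_ac)
  also have "\<dots> = (1 - x) * Bpoly M x (Suc (Suc l)) + x * Bpoly M x (Suc l)"
    unfolding Bpoly_Suc[of M x "Suc l"] Bpoly_Suc[of M x l] by (simp only: ring_distribs)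
  finally show ?case .
qed

text \<open>The subtracted term is the weight of exactly \<open>l\<close> successes in
  \<open>M\<close> trials followed by a further success, the only way an extra trial pushes the
  count above \<open>l\<close>.\<close>

lemma Bpoly_Suc_M:
  "Bpoly (Suc M) x l = Bpoly M x l - x * (real (M choose l) * x ^ l * (1 - x) ^ (M - l))"
proof (cases l)
  case 0
  then show ?thesis by (simp add: Bpoly_0 algebra_simps)
next
  case (Suc j)
  show ?thesis
    unfolding Suc Bpoly_rec Bpoly_Suc[of M] by (simp add: algebra_simps)
qed

text \<open>The added term is the weight of exactly \<open>l + 1\<close> successes in
  \<open>M\<close> trials followed by a failure. It vanishes for \<open>l = M\<close>, which drives
  the induction in \<open>Bpoly_full\<close>.\<close>

lemma Bpoly_Suc_Suc:
  "Bpoly (Suc M) x (Suc l)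
     = Bpoly M x l + (1 - x) * (real (M choose Suc l) * x ^ Suc l * (1 - x) ^ (M - Suc l))"
  unfolding Bpoly_rec Bpoly_Suc[of M] by (simp add: algebra_simps)

lemma Bpoly_at_0: "Bpoly M 0 l = 1"
  by (induction l) (simp_all add: Bpoly_0 Bpoly_Suc)

lemma Bpoly_full: "Bpoly M x M = 1"
  by (induction M) (simp_all add: Bpoly_0 Bpoly_Suc_Suc)

text \<open>For \<open>l > 0\<close>, \<open>Bpoly_rec\<close> makes both sides weighted averages of
  two values for \<open>M\<close>. Passing from \<open>x\<close> to \<open>y\<close> raises neither
  value, by induction, and moves weight to the smaller one.\<close>

lemma Bpoly_antimono:
  assumes "0 \<le> x" "x \<le> y" "y \<le> 1"
  shows "Bpoly M y l \<le> Bpoly M x l"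
proof (induction M arbitrary: l)
  case 0
  show ?case by (induction l) (simp_all add: Bpoly_0 Bpoly_Suc)
next
  case (Suc M)
  show ?case
  proof (cases l)
    case 0
    then show ?thesis using assms by (simp add: Bpoly_0 power_mono del: power_Suc)
  next
    case l: (Suc j)
    have "Bpoly M x j \<le> Bpoly M x (Suc j)"
      using assms by (simp add: Bpoly_Suc)
    then have "0 \<le> (y - x) * (Bpoly M x (Suc j) - Bpoly M x j)"
      using assms by simp
    moreover have "(1 - y) * Bpoly M y (Suc j) + y * Bpoly M y j
        \<le> (1 - y) * Bpoly M x (Suc j) + y * Bpoly M x j"
      using assms Suc.IH by (intro add_mono mult_left_mono) auto
    ultimately show ?thesis
      unfolding l Bpoly_rec by (simp add: algebra_simps)
  qed
qed

text \<open>Writing \<open>t ^ (m - k) / t ^ (N - k)\<close> as \<open>1 / t ^ (N - m)\<close> makes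
  each summand visibly nonincreasing in \<open>t > 0\<close> when
  \<open>a m \<ge> 0\<close>.\<close>

definition hquot ::
  "real \<Rightarrow> (nat \<Rightarrow> real) \<Rightarrow> nat \<Rightarrow> nat \<Rightarrow> real \<Rightarrow> nat \<Rightarrow> nat \<Rightarrow> real" where
  "hquot \<beta> a N M t k l =
     \<beta> * (\<Sum>m=k..N. a m * real (m choose k) / t ^ (N - m)) - real (N choose k) * Bpoly M (1 - t) l"

lemma hpoly_eq_hquot:
  assumes "0 < t"
  shows "hpoly \<beta> a N M t k l = t ^ (N - k) * hquot \<beta> a N M t k l"
proof -
  have "a m * real (m choose k) * t ^ (m - k)
      = t ^ (N - k) * (a m * real (m choose k) / t ^ (N - m))" if "m \<in> {k..N}" for m
  proof -
    have "N - k = (m - k) + (N - m)" using that by simp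
    then show ?thesis using assms by (simp add: power_add)
  qed
  then have "(\<Sum>m=k..N. a m * real (m choose k) * t ^ (m - k))
      = t ^ (N - k) * (\<Sum>m=k..N. a m * real (m choose k) / t ^ (N - m))"
    unfolding sum_distrib_left by (intro sum.cong refl)
  then show ?thesis
    by (simp only: hpoly_def hquot_def right_diff_distrib mult_ac)
qed

text \<open>Strictness comes from the summand at \<open>p\<close>: its weight and
  \<open>p choose k\<close> are positive, and \<open>N - p > 0\<close>. All other terms are compared
  weakly.\<close>

lemma hquot_strict_antimono:
  assumes "0 < \<beta>" "\<forall>m\<in>{0..N}. 0 \<le> a m" "k \<le> p" "p < N" "0 < a p"
    and "0 < s" "s < t" "t \<le> 1"
  shows "hquot \<beta> a N M t k l < hquot \<beta> a N M s k l"
proof -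
  have "(\<Sum>m=k..N. a m * real (m choose k) / t ^ (N - m))
      < (\<Sum>m=k..N. a m * real (m choose k) / s ^ (N - m))"
  proof (rule sum_strict_mono_ex1)
    show "\<forall>m\<in>{k..N}. a m * real (m choose k) / t ^ (N - m) \<le> a m * real (m choose k) / s ^ (N - m)"
      using assms by (intro ballI divide_left_mono power_mono mult_pos_pos zero_less_power) auto
    have "a p * real (p choose k) / t ^ (N - p) < a p * real (p choose k) / s ^ (N - p)"
      using assms
      by (intro divide_strict_left_mono power_strict_mono mult_pos_pos zero_less_power) auto
    then show "\<exists>m\<in>{k..N}. a m * real (m choose k) / t ^ (N - m) < a m * real (m choose k) / s ^ (N - m)"
      using assms by (intro bexI[of _ p]) auto
  qed simp
  moreover have "Bpoly M (1 - s) l \<le> Bpoly M (1 - t) l"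
    using assms by (intro Bpoly_antimono) auto
  then have "real (N choose k) * Bpoly M (1 - s) l \<le> real (N choose k) * Bpoly M (1 - t) l"
    by (intro mult_left_mono) auto
  ultimately show ?thesis
    unfolding hquot_def using assms by (smt (verit) mult_strict_left_mono)
qed

text \<open>At \<open>t = 1\<close> the binomial factor is 1, while the sum is an average of
  \<open>m choose k \<le> N choose k\<close>, so \<open>\<beta> < 1\<close> decides the
  sign.\<close>

lemma hquot_1_neg:
  assumes "0 < \<beta>" "\<beta> < 1" "\<forall>m\<in>{0..N}. 0 \<le> a m" "(\<Sum>m=0..N. a m) = 1" "k \<le> N"
  shows "hquot \<beta> a N M 1 k l < 0"
proof -
  have pos: "0 < real (N choose k)" using assms by simp
  have "(\<Sum>m=k..N. a m * real (m choose k)) \<le> (\<Sum>m=k..N. a m * real (N choose k))"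
    using assms by (intro sum_mono mult_left_mono) (auto intro: binomial_right_mono)
  also have "\<dots> \<le> (\<Sum>m=0..N. a m * real (N choose k))"
    using assms by (intro sum_mono2) auto
  also have "\<dots> = real (N choose k)"
    using assms by (simp flip: sum_distrib_right)
  finally have "\<beta> * (\<Sum>m=k..N. a m * real (m choose k)) \<le> \<beta> * real (N choose k)"
    using assms by (intro mult_left_mono) auto
  also have "\<dots> < real (N choose k)" using pos assms by simp
  finally show ?thesis by (simp add: hquot_def Bpoly_at_0)
qed

lemma hquot_pos_near_0:
  assumes "0 < \<beta>" "\<beta> < 1" "\<forall>m\<in>{0..N}. 0 \<le> a m" "(\<Sum>m=0..N. a m) = 1"
    and "k \<le> p" "p < N" "0 < a p"
  obtains s where "0 < s" "s < 1" "0 < hquot \<beta> a N M s k l"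
proof
  define C where "C = real (N choose k)"
  \<comment> \<open>Chosen so that \<open>\<beta> * a p / s = 2 * C\<close>, twice the bound
    \<open>C\<close> on the subtracted term.\<close>
  define s where "s = \<beta> * a p / (2 * C)"
  have "0 < N choose k" using assms by (intro zero_less_binomial) auto
  then have C: "1 \<le> C" unfolding C_def by linarith
  have "a p \<le> 1"
    using assms member_le_sum[of p "{0..N}" a] by auto
  then have "\<beta> * a p < 1"
    using assms by (smt (verit) mult_less_cancel_left2 mult_left_le)
  then show s1: "s < 1" unfolding s_def using C by (simp add: field_simps)
  show s0: "0 < s" unfolding s_def using assms C by simp
  have "a p / s \<le> a p * real (p choose k) / s ^ (N - p)"
  proof (rule frac_le)
    have "0 < p choose k" using assms by (intro zero_less_binomial) auto
    then have "1 \<le> real (p choose k)" by linarith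
    then show "a p \<le> a p * real (p choose k)" using assms by simp
    show "s ^ (N - p) \<le> s" using s0 s1 assms power_decreasing[of 1 "N - p" s] by simp
  qed (use assms s0 in auto)
  also have "\<dots> \<le> (\<Sum>m=k..N. a m * real (m choose k) / s ^ (N - m))"
    using assms s0 by (intro member_le_sum) auto
  finally have "\<beta> * (a p / s) \<le> \<beta> * (\<Sum>m=k..N. a m * real (m choose k) / s ^ (N - m))"
    using assms by (intro mult_left_mono) auto
  moreover have "\<beta> * (a p / s) = 2 * C"
    unfolding s_def using assms C by (simp add: field_simps)
  moreover have "C * Bpoly M (1 - s) l \<le> C * 1"
    using Bpoly_antimono[of 0 "1 - s" M l] s0 s1 C by (intro mult_left_mono) (auto simp: Bpoly_at_0)
  ultimately show "0 < hquot \<beta> a N M s k l"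
    unfolding hquot_def C_def[symmetric] using C by linarith
qed

lemma troot_is_root:
  assumes "0 < \<beta>" "\<beta> < 1" "\<forall>m\<in>{0..N}. 0 \<le> a m" "(\<Sum>m=0..N. a m) = 1"
    and "k \<le> p" "p < N" "0 < a p"
  shows "0 < troot \<beta> a N M k l" "troot \<beta> a N M k l < 1"
    and "hquot \<beta> a N M (troot \<beta> a N M k l) k l = 0"
proof -
  let ?Q = "\<lambda>t. hquot \<beta> a N M t k l"
  obtain s where s: "0 < s" "s < 1" "0 < ?Q s"
    using hquot_pos_near_0[OF assms] by blast
  have neg: "?Q 1 < 0" using assms by (intro hquot_1_neg) auto
  have "continuous_on {s..1} ?Q"
    unfolding hquot_def Bpoly_def using s by (intro continuous_intros) auto
  then obtain t where t: "s \<le> t" "t \<le> 1" "?Q t = 0"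
    using IVT2'[of ?Q 1 0 s] s neg by auto
  \<comment> \<open>The competing root may lie below \<open>s\<close>, so strict decrease is used on
    all of \<open>(0,1]\<close>.\<close>
  have uniq: "v = t" if "0 < v" "v < 1" "?Q v = 0" for v
    using hquot_strict_antimono[OF assms(1,3,5-7), of v t M l]
      hquot_strict_antimono[OF assms(1,3,5-7), of t v M l] that t s by (cases v t rule: linorder_cases) auto
  have "t \<noteq> 1" using t neg by auto
  then have "troot \<beta> a N M k l = t"
    unfolding troot_def using t s uniq by (intro the_equality) (auto simp: hpoly_eq_hquot)
  then show "0 < troot \<beta> a N M k l" "troot \<beta> a N M k l < 1"
    "hquot \<beta> a N M (troot \<beta> a N M k l) k l = 0"
    using t s \<open>t \<noteq> 1\<close> by auto
qed

lemma troot_less: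
  assumes "0 < \<beta>" "\<beta> < 1" "\<forall>m\<in>{0..N}. 0 \<le> a m" "(\<Sum>m=0..N. a m) = 1"
    and "k \<le> p" "p < N" "0 < a p"
    and less: "\<And>x. 0 < x \<Longrightarrow> x < 1 \<Longrightarrow> Bpoly M' x l' < Bpoly M x l"
  shows "troot \<beta> a N M k l < troot \<beta> a N M' k l'"
proof (rule ccontr)
  let ?t = "troot \<beta> a N M k l" and ?s = "troot \<beta> a N M' k l'"
  note t = troot_is_root[OF assms(1-7), of M l] and s = troot_is_root[OF assms(1-7), of M' l']
  assume "\<not> ?t < ?s"
  \<comment> \<open>If \<open>?s \<le> ?t\<close>, the second quotient is at most 0 at
    \<open>?t\<close>; yet it exceeds the first one, which is 0 there.\<close>
  then have "hquot \<beta> a N M' ?t k l' \<le> hquot \<beta> a N M' ?s k l'"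
    using hquot_strict_antimono[OF assms(1,3,5-7), of ?s ?t M' l'] s t
    by (cases "?s = ?t") auto
  moreover have "0 < N choose k" using assms by (intro zero_less_binomial) auto
  then have "real (N choose k) * Bpoly M' (1 - ?t) l' < real (N choose k) * Bpoly M (1 - ?t) l"
    using less[of "1 - ?t"] t by simp
  then have "hquot \<beta> a N M ?t k l < hquot \<beta> a N M' ?t k l'"
    by (simp add: hquot_def)
  ultimately show False using s t by linarith
qed

theorem theorem6:
  fixes N \<zeta> M :: nat and \<beta> :: real and a :: "nat \<Rightarrow> real"
  assumes "\<zeta> < N" and "1 \<le> M"
    and "0 < \<beta>" and "\<beta> < 1"
    and "\<forall>m\<in>{0..N}. 0 \<le> a m"
    and "0 < (\<Sum>m=\<zeta>..N-1. a m)"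
    and "(\<Sum>m=0..N. a m) = 1"
  shows "\<forall>k\<in>{0..\<zeta>}.
      (\<forall>l\<in>{0..M}. troot \<beta> a N M k l < troot \<beta> a N (M + 1) k l)
    \<and> (\<forall>l\<in>{0..M-1}. troot \<beta> a N (M + 1) k (l + 1) < troot \<beta> a N M k l)
    \<and> troot \<beta> a N (M + 1) k (M + 1) = troot \<beta> a N M k M
    \<and> (\<forall>l\<in>{0..M}. eps \<beta> a N M k l > eps \<beta> a N (M + 1) k l)
    \<and> (\<forall>l\<in>{0..M-1}. eps \<beta> a N (M + 1) k (l + 1) > eps \<beta> a N M k l)
    \<and> eps \<beta> a N (M + 1) k (M + 1) = eps \<beta> a N M k M"
proof (intro ballI)
  fix k assume "k \<in> {0..\<zeta>}"
  obtain p where "p \<in> {\<zeta>..N-1}" "0 < a p"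
    using assms(6) by (meson not_less sum_nonpos)
  then have p: "k \<le> p" "p < N" "0 < a p"
    using \<open>k \<in> {0..\<zeta>}\<close> assms(1) by auto
  have up: "troot \<beta> a N M k l < troot \<beta> a N (M + 1) k l" if "l \<in> {0..M}" for l
    using that by (intro troot_less[OF assms(3,4,5,7) p]) (simp add: Bpoly_Suc_M)
  have down: "troot \<beta> a N (M + 1) k (l + 1) < troot \<beta> a N M k l" if "l \<in> {0..M-1}" for l
  proof (rule troot_less[OF assms(3,4,5,7) p])
    \<comment> \<open>This makes \<open>M choose Suc l\<close> positive, hence the inequality
      strict.\<close>
    have "Suc l \<le> M" using that assms(2) by auto
    then show "Bpoly M x l < Bpoly (M + 1) x (l + 1)" if "0 < x" "x < 1" for x
      using that by (simp add: Bpoly_Suc_Suc)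
  qed
  \<comment> \<open>Both binomial factors are identically 1, so the two roots solve the same
    equation.\<close>
  have "troot \<beta> a N (M + 1) k (M + 1) = troot \<beta> a N M k M"
    unfolding troot_def hpoly_def Bpoly_full ..
  then show "(\<forall>l\<in>{0..M}. troot \<beta> a N M k l < troot \<beta> a N (M + 1) k l)
    \<and> (\<forall>l\<in>{0..M-1}. troot \<beta> a N (M + 1) k (l + 1) < troot \<beta> a N M k l)
    \<and> troot \<beta> a N (M + 1) k (M + 1) = troot \<beta> a N M k M
    \<and> (\<forall>l\<in>{0..M}. eps \<beta> a N M k l > eps \<beta> a N (M + 1) k l)
    \<and> (\<forall>l\<in>{0..M-1}. eps \<beta> a N (M + 1) k (l + 1) > eps \<beta> a N M k l)
    \<and> eps \<beta> a N (M + 1) k (M + 1) = eps \<beta> a N M k M"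
    unfolding eps_def using up down by auto
qed

end
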